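(* Let $\kappa, r, \ell$ be nonnegative integers, let $g\in\mathcal{B}_\ell/\mathcal{B}_r$, let $t_0\in\mathbb{T}$, and let $f\in\mathcal{S}_\kappa$ be such that $$f(z)=g(z)+o((z-t_0)^{2\kappa+2\ell+1})$$ as $z\in\mathbb{D}$ tends to $t_0$ nontangentially. Then $f\equiv g$.
   Context: $\mathbb{D}$ is the open unit disk and $\mathbb{T}$ the unit circle in $\mathbb{C}$. $\mathcal{S}$ is the Schur class: the closed unit ball of $H^\infty(\mathbb{D})$, i.e. analytic functions on $\mathbb{D}$ bounded by one in modulus. $\mathcal{B}_k$ is the set of all finite Blaschke products of degree $k$ (a unimodular constant factor is allowed; $\mathcal{B}_0$ consists of unimodular constants). $\mathcal{B}_p/\mathcal{B}_q$ is the set of all coprime quotients $g=b/\theta$ with $b\in\mathcal{B}_p$ and $\theta\in\mathcal{B}_q$ (coprime: no common zeros in $\mathbb{D}$); equivalently, the set of all rational functions unimodular on $\mathbb{T}$ with $p$ zeros and $q$ poles in $\mathbb{D}$, counted with multiplicities. The generalized Schur class $\mathcal{S}_\kappa$ consists of all coprime quotients $f=s/b$ with $s\in\mathcal{S}$ and $b\in\mathcal{B}_\kappa$ (no common zeros in $\mathbb{D}$). Functions in these classes are regarded as meromorphic functions on $\mathbb{D}$. "$z$ tends to $t_0$ nontangentially" means that $z\to t_0$ within any fixed nontangential approach region (Stolz angle) in $\mathbb{D}$ with vertex $t_0\in\mathbb{T}$. *)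

theory Defs
  imports "HOL-Complex_Analysis.Complex_Analysis" "HOL-Library.Landau_Symbols"
begin

text \<open>
  All classes below consist of functions on the open unit disk \<open>ball 0 1\<close>. Their members are
  functions of type \<open>complex \<Rightarrow> complex\<close> of which only the values on the disk are
  constrained.
\<close>

definition schur_class :: "(complex \<Rightarrow> complex) set" where
  "schur_class = {s. s holomorphic_on ball 0 1 \<and> (\<forall>z\<in>ball 0 1. norm (s z) \<le> 1)}"

definition blaschke_products :: "nat \<Rightarrow> (complex \<Rightarrow> complex) set" where
  "blaschke_products k =
     {b. \<exists>c a. norm c = 1 \<and> (\<forall>i<k. a i \<in> ball 0 1) \<and>
        (\<forall>z\<in>ball 0 1. b z = c * (\<Prod>i<k. (z - a i) / (1 - cnj (a i) * z)))}"

definition no_common_zeros :: "(complex \<Rightarrow> complex) \<Rightarrow> (complex \<Rightarrow> complex) \<Rightarrow> bool" where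
  "no_common_zeros u v \<longleftrightarrow> \<not> (\<exists>z\<in>ball 0 1. u z = 0 \<and> v z = 0)"

text \<open>
  Coprime quotients are meromorphic functions on the disk. Since \<open>x / 0 = 0\<close>, and since by
  coprimeness every zero of the denominator is a pole of the quotient, such a function takes the
  value 0 exactly at its zeros and poles, as in \<^const>\<open>nicely_meromorphic_on\<close>. Hence two
  coprime quotients are equal as meromorphic functions iff they agree at all points of the disk.
\<close>

definition blaschke_quotients :: "nat \<Rightarrow> nat \<Rightarrow> (complex \<Rightarrow> complex) set" where
  "blaschke_quotients p q =
     {g. \<exists>b\<in>blaschke_products p. \<exists>\<theta>\<in>blaschke_products q.
        no_common_zeros b \<theta> \<and> (\<forall>z\<in>ball 0 1. g z = b z / \<theta> z)}"

definition generalized_schur_class :: "nat \<Rightarrow> (complex \<Rightarrow> complex) set" where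
  "generalized_schur_class \<kappa> =
     {f. \<exists>s\<in>schur_class. \<exists>b\<in>blaschke_products \<kappa>.
        no_common_zeros s b \<and> (\<forall>z\<in>ball 0 1. f z = s z / b z)}"

text \<open>
  The nontangential approach region (Stolz angle) with vertex \<open>t\<close> on the unit circle and
  aperture \<open>M > 1\<close>; for \<open>M \<le> 1\<close> it is empty.
\<close>

definition stolz_angle :: "complex \<Rightarrow> real \<Rightarrow> complex set" where
  "stolz_angle t M = {z \<in> ball 0 1. norm (z - t) < M * (1 - norm z)}"

end

theory Submission
  imports Defs "HOL-Real_Asymp.Real_Asymp"
begin

text \<open>
  Write \<open>f = s / b\<close> and \<open>g = h / \<theta>\<close>. Since \<open>f - g = (s * \<theta> - b * h) / (b * \<theta>)\<close> and
  \<open>b * \<theta>\<close> is bounded by 1, the Schur function \<open>S = s * \<theta>\<close> agrees with the finite Blaschke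
  product \<open>B = b * h\<close>, of degree \<open>n = \<kappa> + l\<close>, up to \<open>o((z - t0) ^ (2 * n + 1))\<close>. It is therefore
  enough to know that a finite Blaschke product of degree \<open>n\<close> is determined among all Schur
  functions by its radial expansion to this order at a single boundary point
  (\<open>blaschke_boundary_rigidity\<close>), which is a Burns-Krantz type theorem. Coprimeness then turns
  \<open>s * \<theta> = b * h\<close> into equality of the two quotients, poles included.
  
  The rigidity theorem becomes transparent in the right half-plane. The substitution
  \<open>w = (t0 + z) / (t0 - z)\<close> sends \<open>t0\<close> to infinity, and a Cayley transform of the values, after
  a rotation that avoids the pole of the transform, turns \<open>S\<close> into a function \<open>F\<close> with
  \<open>Re F \<ge> 0\<close>, and \<open>B\<close> into a rational function \<open>G = u / v\<close> of degree \<open>n\<close> that is purely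
  imaginary on the imaginary axis. The hypothesis says \<open>F x - G x = o(x ^ (-2n-1))\<close> along the
  positive reals. Now expand both functions into a continued fraction at infinity
  (\<open>half_plane_rigidity\<close>). With \<open>\<gamma> = G(\<infinity>)\<close>, which is imaginary, and \<open>a = lim x (G x - \<gamma>)\<close>,
  which is real, one has \<open>x (F x - \<gamma>) \<longlonglongrightarrow> a\<close> and hence \<open>a \<ge> 0\<close>.
  
  \<^item> If \<open>a = 0\<close>, then \<open>Re F\<close> decays faster than \<open>1 / x\<close>. Harnack's inequality forbids this for a
    non-constant \<open>F\<close> (\<open>half_plane_Hopf\<close>), so \<open>F\<close> is the constant \<open>\<gamma>\<close>; a rational function of
    degree \<open>n\<close> that is so close to \<open>\<gamma>\<close> equals \<open>\<gamma>\<close>.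
  
  \<^item> If \<open>a > 0\<close>, then \<open>1 / (F - \<gamma>) - w / a\<close> again has nonnegative real part by Julia's lemma
    (\<open>half_plane_Julia\<close>). The same operation on \<open>G\<close> lowers its degree by one, and it
    multiplies the difference of the two functions by a factor of order \<open>x ^ 2\<close>, which is
    exactly the loss of order that the smaller degree permits. Induction on the degree applies.
  
  Both half-plane lemmas are limits of one inequality, the Schwarz-Pick lemma for the
  half-plane, with one of the two points moving to infinity.
\<close>

section \<open>Limits of polynomials at infinity\<close>

lemma filterlim_complex_of_real_at_infinity: "filterlim complex_of_real at_infinity at_top"
  by (simp add: filterlim_at_infinity_conv_norm_at_top filterlim_abs_real)

lemma tendsto_inverse_complex_of_real: "((\<lambda>x. inverse (complex_of_real x)) \<longlongrightarrow> 0) at_top"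
  by (rule filterlim_compose[OF tendsto_inverse_0 filterlim_complex_of_real_at_infinity])

lemma poly_over_power_tendsto_coeff:
  fixes p :: "complex poly"
  assumes "degree p \<le> n"
  shows "((\<lambda>w. poly p w / w ^ n) \<longlongrightarrow> coeff p n) at_infinity"
  using assms
proof (induction p arbitrary: n)
  case 0
  then show ?case by simp
next
  case (pCons a p)
  show ?case
  proof (cases n)
    case 0
    then have "p = 0" using pCons.prems by (auto split: if_splits)
    then show ?thesis using 0 by simp
  next
    case (Suc m)
    then have "degree p \<le> m" using pCons.prems by (auto split: if_splits)
    note IH = pCons.IH[OF this]
    have "((\<lambda>w. a * inverse w ^ Suc m + poly p w / w ^ m) \<longlongrightarrow> a * 0 ^ Suc m + coeff p m) at_infinity"
      by (intro tendsto_intros tendsto_inverse_0 IH)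
    moreover have "eventually (\<lambda>w. a * inverse w ^ Suc m + poly p w / w ^ m = poly (pCons a p) w / w ^ n) at_infinity"
      by (rule eventually_mono[OF eventually_not_equal_at_infinity[of 0]])
         (simp add: Suc field_simps)
    ultimately have "((\<lambda>w. poly (pCons a p) w / w ^ n) \<longlongrightarrow> a * 0 ^ Suc m + coeff p m) at_infinity"
      by (rule Lim_transform_eventually)
    then show ?thesis using Suc by simp
  qed
qed

lemma poly_eq_0_if_tendsto_0:
  fixes p :: "complex poly"
  assumes lim: "((\<lambda>x. poly p (of_real x)) \<longlongrightarrow> 0) at_top"
  shows "p = 0"
proof -
  have "((\<lambda>x. poly p (of_real x) / of_real x ^ degree p) \<longlongrightarrow> coeff p (degree p)) at_top"
    by (rule filterlim_compose[OF poly_over_power_tendsto_coeff filterlim_complex_of_real_at_infinity]) simp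
  moreover have "((\<lambda>x. poly p (of_real x) * (inverse (of_real x)) ^ degree p) \<longlongrightarrow> 0 * 0 ^ degree p) at_top"
    by (intro tendsto_mult tendsto_power lim tendsto_inverse_complex_of_real)
  ultimately have "coeff p (degree p) = 0"
    by (intro tendsto_unique[of at_top]) (auto simp: divide_inverse power_inverse)
  then show ?thesis by simp
qed

lemma poly_quotient_tendsto:
  fixes u v :: "complex poly"
  assumes "degree u \<le> degree v" "v \<noteq> 0"
  shows "((\<lambda>w. poly u w / poly v w) \<longlongrightarrow> coeff u (degree v) / lead_coeff v) at_infinity"
proof -
  have "((\<lambda>w. (poly u w / w ^ degree v) / (poly v w / w ^ degree v)) \<longlongrightarrow> coeff u (degree v) / lead_coeff v) at_infinity"
    by (intro tendsto_divide poly_over_power_tendsto_coeff) (use assms in auto)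
  moreover have "eventually (\<lambda>w. (poly u w / w ^ degree v) / (poly v w / w ^ degree v) = poly u w / poly v w) at_infinity"
    by (rule eventually_mono[OF eventually_not_equal_at_infinity[of 0]]) simp
  ultimately show ?thesis by (rule Lim_transform_eventually)
qed

lemma eventually_poly_nonzero:
  fixes p :: "complex poly"
  assumes "p \<noteq> 0"
  shows "eventually (\<lambda>x. poly p (of_real x) \<noteq> 0) at_top"
proof -
  have "eventually (\<lambda>w. poly p w / w ^ degree p \<noteq> 0) at_infinity"
    by (rule tendsto_imp_eventually_ne[OF poly_over_power_tendsto_coeff]) (use assms in auto)
  then have "eventually (\<lambda>w. poly p w \<noteq> 0) at_infinity"
    by (rule eventually_mono) auto
  then show ?thesis
    by (rule eventually_compose_filterlim[OF _ filterlim_complex_of_real_at_infinity])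
qed

section \<open>Functions with nonnegative real part on the right half-plane\<close>

lemma Re_quotient: "Re (a / b) = Re (a * cnj b) / (cmod b)\<^sup>2"
  by (subst complex_div_cnj) (simp only: Re_divide_of_real)

lemma norm_add_cnj_sq:
  fixes w v :: complex
  shows "(cmod (w + cnj v))\<^sup>2 = (cmod (w - v))\<^sup>2 + 4 * Re w * Re v"
  by (simp add: cmod_power2) (simp add: power2_eq_square algebra_simps)

text \<open>
  The Schwarz lemma, with \<open>v\<close> and \<open>F v\<close> moved to 0 by Cayley transforms, bounds
  \<open>\<bar>F w - F v\<bar> / \<bar>F w + cnj (F v)\<bar>\<close> by \<open>\<bar>w - v\<bar> / \<bar>w + cnj v\<bar>\<close>; by \<open>norm_add_cnj_sq\<close> this is
  the form below, which is free of denominators.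
\<close>

lemma Schwarz_Pick_half_plane_open:
  assumes hol: "F holomorphic_on {w. Re w > 0}"
    and pos: "\<And>w. Re w > 0 \<Longrightarrow> Re (F w) > 0"
    and w: "Re w > 0" and v: "Re v > 0"
  shows "(cmod (F w + cnj (F v)))\<^sup>2 * (Re w * Re v) \<le> (cmod (w + cnj v))\<^sup>2 * (Re (F w) * Re (F v))"
proof -
  \<comment> \<open>The inverse of \<open>w \<mapsto> (w - v) / (w + cnj v)\<close>, from the disk onto the half-plane.\<close>
  define \<phi> where "\<phi> \<zeta> = (v + cnj v * \<zeta>) / (1 - \<zeta>)" for \<zeta>
  define g where "g \<zeta> = (F (\<phi> \<zeta>) - F v) / (F (\<phi> \<zeta>) + cnj (F v))" for \<zeta>
  have Re_\<phi>: "Re (\<phi> \<zeta>) > 0" if "cmod \<zeta> < 1" for \<zeta>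
  proof -
    have ne: "1 - \<zeta> \<noteq> 0" using that by auto
    have "Re (\<phi> \<zeta>) = Re ((v + cnj v * \<zeta>) * cnj (1 - \<zeta>)) / (cmod (1 - \<zeta>))\<^sup>2"
      unfolding \<phi>_def by (rule Re_quotient)
    also have "Re ((v + cnj v * \<zeta>) * cnj (1 - \<zeta>)) = Re v * (1 - (cmod \<zeta>)\<^sup>2)"
      by (simp add: cmod_power2) (simp add: power2_eq_square algebra_simps)
    finally show ?thesis using ne v that by (simp add: power_less_one_iff abs_square_less_1)
  qed
  have ne: "F w' + cnj (F v) \<noteq> 0" if "Re w' > 0" for w'
    using pos[OF that] pos[OF v] by (metis add_pos_pos complex_cnj less_irrefl plus_complex.simps(1) zero_complex.simps(1) cnj.simps(1))
  have "g holomorphic_on ball 0 1"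
  proof -
    have "\<phi> holomorphic_on ball 0 1"
      unfolding \<phi>_def by (intro holomorphic_intros) auto
    then have "(F \<circ> \<phi>) holomorphic_on ball 0 1"
      by (rule holomorphic_on_compose_gen[OF _ hol]) (auto simp: Re_\<phi>)
    then have *: "(\<lambda>\<zeta>. F (\<phi> \<zeta>)) holomorphic_on ball 0 1" by (simp add: o_def)
    show ?thesis unfolding g_def
      by (intro holomorphic_intros *) (auto intro!: ne Re_\<phi>)
  qed
  moreover have "cmod (g \<zeta>) < 1" if "cmod \<zeta> < 1" for \<zeta>
  proof -
    have "(cmod (F (\<phi> \<zeta>) - F v))\<^sup>2 < (cmod (F (\<phi> \<zeta>) + cnj (F v)))\<^sup>2"
      using norm_add_cnj_sq[of "F (\<phi> \<zeta>)" "F v"] pos[OF Re_\<phi>[OF that]] pos[OF v] by simp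
    then have "cmod (F (\<phi> \<zeta>) - F v) < cmod (F (\<phi> \<zeta>) + cnj (F v))"
      using norm_ge_zero power2_less_imp_less by blast
    then show ?thesis using ne[OF Re_\<phi>[OF that]] by (simp add: g_def norm_divide)
  qed
  moreover have "g 0 = 0" by (simp add: g_def \<phi>_def)
  ultimately have Schwarz: "cmod (g \<zeta>) \<le> cmod \<zeta>" if "cmod \<zeta> < 1" for \<zeta>
    using Schwarz_Lemma(1)[of g \<zeta>] that by auto
  define \<zeta> where "\<zeta> = (w - v) / (w + cnj v)"
  have ne': "w + cnj v \<noteq> 0"
    using w v by (metis add_pos_pos less_irrefl plus_complex.simps(1) zero_complex.simps(1) cnj.simps(1))
  have "(cmod (w - v))\<^sup>2 < (cmod (w + cnj v))\<^sup>2"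
    using norm_add_cnj_sq[of w v] w v by simp
  then have "cmod (w - v) < cmod (w + cnj v)"
    using norm_ge_zero power2_less_imp_less by blast
  then have \<zeta>: "cmod \<zeta> < 1" using ne' by (simp add: \<zeta>_def norm_divide)
  have "1 - \<zeta> = (v + cnj v) / (w + cnj v)" "v + cnj v * \<zeta> = w * (v + cnj v) / (w + cnj v)"
    using ne' by (auto simp: \<zeta>_def field_simps)
  moreover have "v + cnj v \<noteq> 0" using v by (simp add: complex_eq_iff)
  ultimately have \<phi>\<zeta>: "\<phi> \<zeta> = w" using ne' by (simp add: \<phi>_def)
  have "cmod (F w - F v) / cmod (F w + cnj (F v)) \<le> cmod (w - v) / cmod (w + cnj v)"
    using Schwarz[OF \<zeta>] unfolding g_def \<phi>\<zeta> by (simp add: \<zeta>_def norm_divide)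
  then have "cmod (F w - F v) * cmod (w + cnj v) \<le> cmod (w - v) * cmod (F w + cnj (F v))"
    using ne[OF w] ne' by (simp add: field_simps)
  then have "(cmod (F w - F v) * cmod (w + cnj v))\<^sup>2 \<le> (cmod (w - v) * cmod (F w + cnj (F v)))\<^sup>2"
    by (simp add: power_mono)
  then show ?thesis
    using norm_add_cnj_sq[of "F w" "F v"] norm_add_cnj_sq[of w v]
    by (simp add: power_mult_distrib algebra_simps)
qed

text \<open>
  The case of nonnegative real part follows from the strict one by letting \<open>\<epsilon>\<close> tend to 0 in
  \<open>F + \<epsilon>\<close>.
\<close>

lemma Schwarz_Pick_half_plane:
  assumes hol: "F holomorphic_on {w. Re w > 0}"
    and pos: "\<And>w. Re w > 0 \<Longrightarrow> Re (F w) \<ge> 0"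
    and w: "Re w > 0" and v: "Re v > 0"
  shows "(cmod (F w + cnj (F v)))\<^sup>2 * (Re w * Re v) \<le> (cmod (w + cnj v))\<^sup>2 * (Re (F w) * Re (F v))"
proof (rule tendsto_le[of "at_right (0::real)"])
  let ?l = "\<lambda>\<epsilon>. (cmod ((F w + of_real \<epsilon>) + cnj (F v + of_real \<epsilon>)))\<^sup>2 * (Re w * Re v)"
  let ?r = "\<lambda>\<epsilon>. (cmod (w + cnj v))\<^sup>2 * (Re (F w + of_real \<epsilon>) * Re (F v + of_real \<epsilon>))"
  have "isCont ?l 0" "isCont ?r 0" by (auto intro!: continuous_intros)
  then show "(?l \<longlongrightarrow> (cmod (F w + cnj (F v)))\<^sup>2 * (Re w * Re v)) (at_right 0)"
    "(?r \<longlongrightarrow> (cmod (w + cnj v))\<^sup>2 * (Re (F w) * Re (F v))) (at_right 0)"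
    by (auto simp: isCont_def intro: filterlim_mono[OF _ order_refl at_le] tendsto_within_subset)
  have "?l \<epsilon> \<le> ?r \<epsilon>" if "\<epsilon> > 0" for \<epsilon>
    by (rule Schwarz_Pick_half_plane_open[where F = "\<lambda>w. F w + of_real \<epsilon>"])
       (use assms that in \<open>auto intro!: holomorphic_intros add_nonneg_pos\<close>)
  then show "eventually (\<lambda>\<epsilon>. ?l \<epsilon> \<le> ?r \<epsilon>) (at_right 0)"
    by (auto simp: eventually_at_right_less intro: eventually_mono[OF eventually_at_right_less])
qed simp

lemma half_plane_constant_if_Re_zero:
  assumes hol: "F holomorphic_on {w. Re w > 0}"
    and pos: "\<And>w. Re w > 0 \<Longrightarrow> Re (F w) \<ge> 0"
    and w: "Re w > 0" and Re0: "Re (F w) = 0" and v: "Re v > 0"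
  shows "F v = F w"
proof -
  have "(cmod (F w + cnj (F v)))\<^sup>2 * (Re w * Re v) \<le> 0"
    using Schwarz_Pick_half_plane[OF hol pos w v] Re0 by simp
  then have "F w + cnj (F v) = 0" using w v by (simp add: mult_le_0_iff)
  then show ?thesis using Re0 by (simp add: complex_eq_iff)
qed

text \<open>
  Taking real parts in the Schwarz-Pick inequality gives Harnack's inequality, by which
  \<open>x * Re (F x)\<close> stays above a positive multiple of \<open>Re (F w)\<close> as \<open>x\<close> grows. So the limit 0
  forces \<open>Re F = 0\<close>, and then \<open>F\<close> is constant.
\<close>

lemma half_plane_Hopf:
  assumes hol: "F holomorphic_on {w. Re w > 0}"
    and pos: "\<And>w. Re w > 0 \<Longrightarrow> Re (F w) \<ge> 0"
    and lim: "((\<lambda>x. of_real x * (F (of_real x) - \<gamma>)) \<longlongrightarrow> 0) at_top"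
    and \<gamma>: "Re \<gamma> = 0" and w: "Re w > 0"
  shows "F w = \<gamma>"
proof -
  have lim': "((\<lambda>x. x * Re (F (of_real x))) \<longlongrightarrow> 0) at_top"
    using tendsto_Re[OF lim] \<gamma> by simp
  have Re0: "Re (F w) = 0" if w: "Re w > 0" for w
  proof (rule ccontr)
    assume "Re (F w) \<noteq> 0"
    then have P: "Re (F w) > 0" using pos[OF w] by simp
    have "Re (F w) * Re w \<le> (cmod (w / of_real x + 1))\<^sup>2 * (x * Re (F (of_real x)))"
      if x: "x > 0" for x
    proof -
      have "0 \<le> Re (F (of_real x))" using pos x by simp
      then have "(Re (F w))\<^sup>2 \<le> (Re (F w + cnj (F (of_real x))))\<^sup>2"
        using P by (intro power_mono) auto
      also have "\<dots> \<le> (cmod (F w + cnj (F (of_real x))))\<^sup>2"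
        by (simp add: cmod_power2)
      finally have "(Re (F w))\<^sup>2 * (Re w * x) \<le> (cmod (F w + cnj (F (of_real x))))\<^sup>2 * (Re w * x)"
        using w x by (intro mult_right_mono) auto
      also have "\<dots> \<le> (cmod (w + of_real x))\<^sup>2 * (Re (F w) * Re (F (of_real x)))"
        using Schwarz_Pick_half_plane[OF hol pos w, of "of_real x"] x by simp
      also have "w + of_real x = of_real x * (w / of_real x + 1)" using x by (simp add: field_simps)
      finally have "(Re (F w) * x) * (Re (F w) * Re w)
          \<le> (Re (F w) * x) * ((cmod (w / of_real x + 1))\<^sup>2 * (x * Re (F (of_real x))))"
        by (simp only: norm_mult power_mult_distrib norm_of_real power2_abs)
           (simp add: power2_eq_square algebra_simps)
      then show ?thesis by (rule mult_left_le_imp_le) (use P x in auto)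
    qed
    then have ev: "eventually (\<lambda>x. Re (F w) * Re w \<le> (cmod (w / of_real x + 1))\<^sup>2 * (x * Re (F (of_real x)))) at_top"
      by (rule eventually_mono[OF eventually_gt_at_top[of 0]])
    have "((\<lambda>x::real. w / of_real x) \<longlongrightarrow> 0) at_top"
      by (intro tendsto_divide_0[OF tendsto_const] filterlim_complex_of_real_at_infinity)
    then have "((\<lambda>x. (cmod (w / of_real x + 1))\<^sup>2 * (x * Re (F (of_real x)))) \<longlongrightarrow> (cmod (0 + 1))\<^sup>2 * 0) at_top"
      by (intro tendsto_intros lim')
    from tendsto_lowerbound[OF this ev] have "Re (F w) * Re w \<le> 0" by simp
    then show False using P w by (simp add: mult_le_0_iff)
  qed
  have const: "F (of_real x) = F w" if "x > 0" for x
    using half_plane_constant_if_Re_zero[OF hol pos w Re0[OF w], of "of_real x"] that by simp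
  have "((\<lambda>x. inverse (of_real x) * (of_real x * (F (of_real x) - \<gamma>))) \<longlongrightarrow> 0 * 0) at_top"
    by (intro tendsto_mult lim filterlim_compose[OF tendsto_inverse_0]
        filterlim_complex_of_real_at_infinity)
  moreover have "eventually (\<lambda>x. inverse (of_real x) * (of_real x * (F (of_real x) - \<gamma>)) = F w - \<gamma>) at_top"
    by (rule eventually_mono[OF eventually_gt_at_top[of 0]]) (simp add: const)
  ultimately have "((\<lambda>x::real. F w - \<gamma>) \<longlongrightarrow> 0 * 0) at_top"
    by (rule Lim_transform_eventually)
  then show ?thesis by (simp add: tendsto_const_iff)
qed

text \<open>
  Julia's lemma with the boundary point at infinity: divide the Schwarz-Pick inequality for
  \<open>w\<close> and \<open>x\<close> by \<open>x ^ 3\<close> and let \<open>x\<close> tend to infinity.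
\<close>

lemma half_plane_Julia:
  assumes hol: "F holomorphic_on {w. Re w > 0}"
    and pos: "\<And>w. Re w > 0 \<Longrightarrow> Re (F w) \<ge> 0"
    and lim: "((\<lambda>x. F (of_real x) / of_real x) \<longlongrightarrow> of_real m) at_top"
    and m: "m > 0" and w: "Re w > 0"
  shows "Re (F w) \<ge> m * Re w"
proof -
  let ?q = "\<lambda>x::real. F (of_real x) / of_real x"
  have "((\<lambda>x::real. c / of_real x) \<longlongrightarrow> (0::complex)) at_top" for c
    by (intro tendsto_divide_0[OF tendsto_const] filterlim_complex_of_real_at_infinity)
  note lims = this lim
  have le: "(cmod (F w / of_real x + cnj (?q x)))\<^sup>2 * Re w \<le> (cmod (w / of_real x + 1))\<^sup>2 * (Re (F w) * Re (?q x))"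
    if x: "x > 0" for x
  proof -
    define q where "q = ?q x"
    have eq: "F w + cnj (of_real x * q) = of_real x * (F w / of_real x + cnj q)"
      "w + of_real x = of_real x * (w / of_real x + 1)" "Re (of_real x * q) = x * Re q"
      using x by (simp_all add: field_simps)
    have "F (of_real x) = of_real x * q"
      using x by (simp add: q_def)
    then have "(cmod (F w + cnj (of_real x * q)))\<^sup>2 * (Re w * x)
        \<le> (cmod (w + of_real x))\<^sup>2 * (Re (F w) * Re (of_real x * q))"
      using Schwarz_Pick_half_plane[OF hol pos w, of "of_real x"] x by simp
    then have "x^3 * ((cmod (F w / of_real x + cnj q))\<^sup>2 * Re w)
        \<le> x^3 * ((cmod (w / of_real x + 1))\<^sup>2 * (Re (F w) * Re q))"
      unfolding eq
      by (simp only: norm_mult power_mult_distrib norm_of_real power2_abs)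
         (simp add: power3_eq_cube power2_eq_square mult_ac)
    then show ?thesis unfolding q_def by (rule mult_left_le_imp_le) (use x in simp)
  qed
  have "((\<lambda>x. (cmod (F w / of_real x + cnj (?q x)))\<^sup>2 * Re w)
      \<longlongrightarrow> (cmod (0 + cnj (of_real m)))\<^sup>2 * Re w) at_top"
    by (intro tendsto_mult tendsto_add tendsto_power tendsto_norm tendsto_cnj tendsto_const lims)
  moreover have "((\<lambda>x. (cmod (w / of_real x + 1))\<^sup>2 * (Re (F w) * Re (?q x)))
      \<longlongrightarrow> (cmod (0 + 1))\<^sup>2 * (Re (F w) * Re (of_real m))) at_top"
    by (intro tendsto_mult tendsto_add tendsto_power tendsto_norm tendsto_Re tendsto_const lims)
  ultimately have "(cmod (0 + cnj (of_real m)))\<^sup>2 * Re w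
      \<le> (cmod (0 + 1))\<^sup>2 * (Re (F w) * Re (of_real m))"
    by (intro tendsto_le[OF _ _ _ eventually_mono[OF eventually_gt_at_top[of 0] le]]) auto
  then have "m * (m * Re w) \<le> m * Re (F w)" by (simp add: power2_eq_square mult_ac)
  then show ?thesis using m by (simp add: mult_le_cancel_left)
qed

section \<open>Rigidity at infinity in the half-plane\<close>

lemma filterlim_imaginary_axis: "filterlim (\<lambda>y. \<i> * complex_of_real y) at_infinity at_top"
  by (simp add: filterlim_at_infinity_conv_norm_at_top filterlim_abs_real norm_mult)

text \<open>
  The induction peels off one term of the continued fraction of \<open>u / v\<close> at infinity. The
  hypothesis on the imaginary axis, which says that \<open>u / v\<close> is imaginary there, survives each
  of the operations: subtraction of an imaginary constant, inversion, and subtraction of a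
  real multiple of \<open>w\<close>.
\<close>

lemma half_plane_rigidity:
  fixes u v :: "complex poly"
  assumes hol: "F holomorphic_on {w. Re w > 0}"
    and pos: "\<And>w. Re w > 0 \<Longrightarrow> Re (F w) \<ge> 0"
    and deg: "degree u \<le> degree v" "v \<noteq> 0"
    and axis: "\<And>y::real. Re (poly u (\<i> * y) * cnj (poly v (\<i> * y))) = 0"
    and lim: "((\<lambda>x. of_real x ^ (2 * degree v + 1) * (F (of_real x) - poly u (of_real x) / poly v (of_real x))) \<longlongrightarrow> 0) at_top"
    and w: "Re w > 0"
  shows "F w * poly v w = poly u w"
  using assms
proof (induction "degree v" arbitrary: F u v w rule: less_induct)
  case less
  note hol = less.prems(1) and pos = less.prems(2) and deg = less.prems(3,4) and axis = less.prems(5)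
    and lim = less.prems(6)
  let ?n = "degree v"
  define \<gamma> where "\<gamma> = coeff u ?n / lead_coeff v"
  \<comment> \<open>The pair \<open>u'\<close>, \<open>v\<close> represents \<open>u / v - \<gamma>\<close>, and \<open>pCons 0 u'\<close> is \<open>w * u'\<close>,
      so \<open>a\<close> is the value at infinity of \<open>w * (u / v - \<gamma>)\<close>.\<close>
  define u' where "u' = u - smult \<gamma> v"
  define a where "a = coeff (pCons 0 u') ?n / lead_coeff v"
  have lc: "lead_coeff v \<noteq> 0" using deg by simp
  have c0: "coeff u' ?n = 0" using lc by (simp add: u'_def \<gamma>_def)
  have deg_u': "degree u' \<le> ?n"
    unfolding u'_def by (rule degree_diff_le) (use deg in auto)
  have deg_wu': "degree (pCons 0 u') \<le> ?n"
  proof (cases "u' = 0")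
    case False
    then have "degree u' \<noteq> ?n" using c0 by (metis leading_coeff_0_iff)
    then show ?thesis using deg_u' by simp
  qed simp
  have Re_\<gamma>: "Re \<gamma> = 0"
  proof -
    have "((\<lambda>y. poly u (\<i> * of_real y) / poly v (\<i> * of_real y)) \<longlongrightarrow> \<gamma>) at_top"
      unfolding \<gamma>_def
      by (rule filterlim_compose[OF poly_quotient_tendsto[OF deg] filterlim_imaginary_axis])
    from tendsto_Re[OF this] show ?thesis
      by (simp only: Re_quotient axis div_0) (simp add: tendsto_const_iff)
  qed
  have axis': "Re (poly u' (\<i> * y) * cnj (poly v (\<i> * y))) = 0" for y :: real
  proof -
    have "poly u' (\<i> * y) * cnj (poly v (\<i> * y))
        = poly u (\<i> * y) * cnj (poly v (\<i> * y)) - \<gamma> * of_real ((cmod (poly v (\<i> * y)))\<^sup>2)"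
      by (simp only: complex_norm_square u'_def) (simp add: algebra_simps)
    then show ?thesis using axis Re_\<gamma> by (simp del: of_real_power)
  qed
  \<comment> \<open>On the imaginary axis \<open>w\<close> and \<open>u / v - \<gamma>\<close> are both imaginary, so their product is real.\<close>
  have Im_a: "Im a = 0"
  proof -
    have "((\<lambda>y. poly (pCons 0 u') (\<i> * of_real y) / poly v (\<i> * of_real y)) \<longlongrightarrow> a) at_top"
      unfolding a_def
      by (rule filterlim_compose[OF poly_quotient_tendsto[OF deg_wu' deg(2)] filterlim_imaginary_axis])
    moreover have "Im (poly (pCons 0 u') (\<i> * of_real y) / poly v (\<i> * of_real y)) = 0" for y
    proof -
      have "poly (pCons 0 u') (\<i> * of_real y) / poly v (\<i> * of_real y)
          = \<i> * (of_real y * (poly u' (\<i> * of_real y) / poly v (\<i> * of_real y)))"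
        by simp
      moreover have "Re (poly u' (\<i> * of_real y) / poly v (\<i> * of_real y)) = 0"
        by (simp only: Re_quotient axis' div_0)
      ultimately show ?thesis by (simp del: poly_pCons times_divide_eq_right)
    qed
    ultimately show ?thesis using tendsto_Im[of _ a at_top] by (fastforce simp: tendsto_const_iff)
  qed
  have ev_v: "eventually (\<lambda>x. poly v (of_real x) \<noteq> 0) at_top"
    by (rule eventually_poly_nonzero[OF deg(2)])
  have u'v: "poly u' x / poly v x = poly u x / poly v x - \<gamma>" if "poly v x \<noteq> 0" for x
    using that by (simp add: u'_def field_simps)
  have limG: "((\<lambda>x. of_real x * (poly u (of_real x) / poly v (of_real x) - \<gamma>)) \<longlongrightarrow> a) at_top"
  proof -
    have "((\<lambda>x. poly (pCons 0 u') (of_real x) / poly v (of_real x)) \<longlongrightarrow> a) at_top"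
      unfolding a_def
      by (rule filterlim_compose[OF poly_quotient_tendsto[OF deg_wu' deg(2)] filterlim_complex_of_real_at_infinity])
    moreover have "eventually (\<lambda>x. poly (pCons 0 u') (of_real x) / poly v (of_real x)
        = of_real x * (poly u (of_real x) / poly v (of_real x) - \<gamma>)) at_top"
      using ev_v by eventually_elim (simp flip: u'v)
    ultimately show ?thesis by (rule Lim_transform_eventually)
  qed
  \<comment> \<open>Agreement to order \<open>2 * n + 1\<close> includes agreement to every lower order.\<close>
  have lim_le: "((\<lambda>x. of_real x ^ k * (F (of_real x) - poly u (of_real x) / poly v (of_real x))) \<longlongrightarrow> 0) at_top"
    if "k \<le> 2 * ?n + 1" for k
  proof -
    have "((\<lambda>x. of_real x ^ (2 * ?n + 1) * (F (of_real x) - poly u (of_real x) / poly v (of_real x))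
        * inverse (of_real x) ^ (2 * ?n + 1 - k)) \<longlongrightarrow> 0 * 0 ^ (2 * ?n + 1 - k)) at_top"
      by (intro tendsto_mult tendsto_power lim tendsto_inverse_complex_of_real)
    moreover have "eventually (\<lambda>x. of_real x ^ (2 * ?n + 1) * (F (of_real x) - poly u (of_real x) / poly v (of_real x))
        * inverse (of_real x) ^ (2 * ?n + 1 - k)
        = of_real x ^ k * (F (of_real x) - poly u (of_real x) / poly v (of_real x))) at_top"
    proof (rule eventually_mono[OF eventually_gt_at_top[of 0]])
      fix x :: real assume "x > 0"
      moreover have "complex_of_real x ^ (2 * ?n + 1) = of_real x ^ k * of_real x ^ (2 * ?n + 1 - k)"
        using that by (simp flip: power_add)
      ultimately show "of_real x ^ (2 * ?n + 1) * (F (of_real x) - poly u (of_real x) / poly v (of_real x))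
        * inverse (of_real x) ^ (2 * ?n + 1 - k)
        = of_real x ^ k * (F (of_real x) - poly u (of_real x) / poly v (of_real x))"
        by (simp add: power_inverse field_simps)
    qed
    ultimately show ?thesis using Lim_transform_eventually by fastforce
  qed
  have limF: "((\<lambda>x. of_real x * (F (of_real x) - \<gamma>)) \<longlongrightarrow> a) at_top"
    using tendsto_add[OF lim_le[of 1] limG] by (simp add: algebra_simps)
  have "Re a \<ge> 0"
  proof (rule tendsto_lowerbound[OF tendsto_Re[OF limF]])
    show "eventually (\<lambda>x. 0 \<le> Re (of_real x * (F (of_real x) - \<gamma>))) at_top"
      by (rule eventually_mono[OF eventually_gt_at_top[of 0]]) (use pos Re_\<gamma> in simp)
  qed simp
  then consider "a = 0" | "Re a > 0" using Im_a by (force simp: complex_eq_iff)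
  then show ?case
  proof cases
    case 1
    have F: "F w = \<gamma>" if "Re w > 0" for w
      using half_plane_Hopf[OF hol pos _ Re_\<gamma> that] limF 1 by simp
    \<comment> \<open>Multiplying \<open>\<gamma> - u / v = o(x ^ (-n))\<close> by \<open>v = O(x ^ n)\<close> shows that the polynomial
        \<open>u' = u - \<gamma> v\<close> tends to 0 along the reals.\<close>
    have "u' = 0"
    proof (rule poly_eq_0_if_tendsto_0)
      have "((\<lambda>x. - (of_real x ^ ?n * (F (of_real x) - poly u (of_real x) / poly v (of_real x)))
          * (poly v (of_real x) / of_real x ^ ?n)) \<longlongrightarrow> - 0 * lead_coeff v) at_top"
        by (intro tendsto_mult tendsto_minus lim_le
            filterlim_compose[OF poly_over_power_tendsto_coeff filterlim_complex_of_real_at_infinity]) auto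
      moreover have "eventually (\<lambda>x. - (of_real x ^ ?n * (F (of_real x) - poly u (of_real x) / poly v (of_real x)))
          * (poly v (of_real x) / of_real x ^ ?n) = poly u' (of_real x)) at_top"
        using ev_v eventually_gt_at_top[of 0]
        by eventually_elim (simp add: F u'_def field_simps)
      ultimately show "((\<lambda>x. poly u' (of_real x)) \<longlongrightarrow> 0) at_top"
        using Lim_transform_eventually by fastforce
    qed
    then show ?thesis using F[OF less.prems(7)] by (simp add: u'_def)
  next
    case 2
    define m where "m = 1 / Re a"
    have a: "a = of_real (Re a)" "a \<noteq> 0" using Im_a 2 by (auto simp: complex_eq_iff)
    have m: "m > 0" "of_real m = 1 / a" using 2 a(1) by (auto simp: m_def)
    have u'0: "u' \<noteq> 0" using a(2) by (auto simp: a_def)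
    have deg_v: "?n = Suc (degree u')"
    proof -
      have "coeff (pCons 0 u') ?n \<noteq> 0" using a(2) by (auto simp: a_def)
      then have "?n \<le> degree (pCons 0 u')" by (rule le_degree)
      then show ?thesis using deg_wu' u'0 by simp
    qed
    \<comment> \<open>The next functions of the continued fraction: \<open>u1 / u' = v / u' - w / a\<close>.\<close>
    define F1 where "F1 w = 1 / (F w - \<gamma>) - of_real m * w" for w
    define u1 where "u1 = v - smult (of_real m) (pCons 0 u')"
    \<comment> \<open>A zero of the real part would make \<open>F\<close> constant, contradicting \<open>a > 0\<close>.\<close>
    have Re_F: "Re (F w - \<gamma>) > 0" if w: "Re w > 0" for w
    proof (rule ccontr)
      assume "\<not> ?thesis"
      then have Re0: "Re (F w) = 0" using pos[OF w] Re_\<gamma> by simp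
      have "Re (F (of_real x)) = 0" if "x > 0" for x
        using half_plane_constant_if_Re_zero[OF hol pos w Re0, of "of_real x"] Re0 that by simp
      then have "eventually (\<lambda>x. Re (of_real x * (F (of_real x) - \<gamma>)) = 0) at_top"
        by (intro eventually_mono[OF eventually_gt_at_top[of 0]]) (simp add: Re_\<gamma>)
      with tendsto_Re[OF limF] have "((\<lambda>x::real. 0) \<longlongrightarrow> Re a) at_top"
        by (rule Lim_transform_eventually)
      then show False using 2 by (simp add: tendsto_const_iff)
    qed
    then have F_ne: "F w - \<gamma> \<noteq> 0" if "Re w > 0" for w using that by fastforce
    have hol_inv: "(\<lambda>w. 1 / (F w - \<gamma>)) holomorphic_on {w. Re w > 0}"
      by (intro holomorphic_intros hol) (use F_ne in auto)
    have "F1 w * poly u' w = poly u1 w"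
    proof (rule less.hyps)
      show "degree u' < ?n" using deg_v by simp
      show "F1 holomorphic_on {w. Re w > 0}"
        unfolding F1_def by (intro holomorphic_intros hol_inv)
      show "Re (F1 w) \<ge> 0" if w: "Re w > 0" for w
      proof -
        have "Re (1 / (F w - \<gamma>)) \<ge> m * Re w"
        proof (rule half_plane_Julia[OF hol_inv _ _ m(1) w])
          show "Re (1 / (F w - \<gamma>)) \<ge> 0" if "Re w > 0" for w
            using Re_F[OF that] by (simp add: Re_divide)
          show "((\<lambda>x. 1 / (F (of_real x) - \<gamma>) / of_real x) \<longlongrightarrow> of_real m) at_top"
            using tendsto_divide[OF tendsto_const[of 1] limF a(2)] m(2) by (simp add: mult.commute)
        qed
        then show ?thesis by (simp add: F1_def)
      qed
      show "degree u1 \<le> degree u'"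
      proof -
        \<comment> \<open>The multiple \<open>m = 1 / a\<close> is the one for which the leading coefficients cancel.\<close>
        have "degree u1 \<le> ?n" unfolding u1_def
          by (rule degree_diff_le) (use deg_wu' in \<open>auto intro: order.trans[OF degree_smult_le]\<close>)
        moreover have "coeff u1 ?n = 0"
          using lc a(2) unfolding u1_def coeff_diff coeff_smult m(2) by (simp add: a_def)
        ultimately show ?thesis
          using deg_v by (metis coeff_0_degree_minus_1 diff_Suc_1 le_antisym leading_coeff_0_iff le_Suc_eq degree_0 zero_le)
      qed
      show "u' \<noteq> 0" by (rule u'0)
      show "Re (poly u1 (\<i> * y) * cnj (poly u' (\<i> * y))) = 0" for y :: real
      proof -
        have "poly u1 (\<i> * y) * cnj (poly u' (\<i> * y))
            = cnj (poly u' (\<i> * y) * cnj (poly v (\<i> * y))) - \<i> * of_real (m * y * (cmod (poly u' (\<i> * y)))\<^sup>2)"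
          by (simp only: complex_norm_square of_real_mult u1_def) (simp add: algebra_simps)
        then show ?thesis using axis'[of y] by (simp del: of_real_power of_real_mult)
      qed
      show "((\<lambda>x. of_real x ^ (2 * degree u' + 1) * (F1 (of_real x) - poly u1 (of_real x) / poly u' (of_real x))) \<longlongrightarrow> 0) at_top"
      proof -
        \<comment> \<open>For \<open>A = F - \<gamma>\<close> and \<open>B = u / v - \<gamma>\<close> one has \<open>1 / A - 1 / B = - (A - B) / (A * B)\<close>, where
            \<open>A * B\<close> is asymptotic to \<open>a ^ 2 / x ^ 2\<close>: this costs two orders of agreement.\<close>
        let ?G = "\<lambda>x::real. poly u (of_real x) / poly v (of_real x)"
        have "((\<lambda>x. - (of_real x ^ (2 * ?n + 1) * (F (of_real x) - ?G x))
           / ((of_real x * (F (of_real x) - \<gamma>)) * (of_real x * (?G x - \<gamma>)))) \<longlongrightarrow> - 0 / (a * a)) at_top"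
          by (intro tendsto_divide tendsto_minus tendsto_mult lim limF limG) (use a in auto)
        moreover have "eventually (\<lambda>x. - (of_real x ^ (2 * ?n + 1) * (F (of_real x) - ?G x))
           / ((of_real x * (F (of_real x) - \<gamma>)) * (of_real x * (?G x - \<gamma>)))
           = of_real x ^ (2 * degree u' + 1) * (F1 (of_real x) - poly u1 (of_real x) / poly u' (of_real x))) at_top"
          using ev_v eventually_poly_nonzero[OF u'0] eventually_gt_at_top[of 0]
        proof eventually_elim
          case (elim x)
          define A B where "A = F (of_real x) - \<gamma>" and "B = ?G x - \<gamma>"
          have A: "A \<noteq> 0" using F_ne[of "of_real x"] elim by (simp add: A_def)
          have Beq: "B = poly u' (of_real x) / poly v (of_real x)"
            using u'v[OF elim(1)] by (simp add: B_def)
          then have B: "B \<noteq> 0" using elim by simp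
          have "F1 (of_real x) - poly u1 (of_real x) / poly u' (of_real x) = 1 / A - 1 / B"
            using elim by (simp add: F1_def u1_def Beq A_def[symmetric] field_simps)
          also have "\<dots> = - (A - B) / (A * B)" using A B by (simp add: field_simps)
          finally have eq: "F1 (of_real x) - poly u1 (of_real x) / poly u' (of_real x) = - (A - B) / (A * B)" .
          have "F (of_real x) - ?G x = A - B" by (simp add: A_def B_def)
          moreover have "complex_of_real x ^ (2 * ?n + 1) = of_real x ^ (2 * degree u' + 1) * of_real x * of_real x"
            by (simp add: deg_v)
          ultimately show ?case unfolding eq using A B elim(3)
            by (simp only: A_def[symmetric] B_def[symmetric]) (simp add: field_simps)
        qed
        ultimately show ?thesis using Lim_transform_eventually by fastforce
      qed
      show "Re w > 0" by (rule less.prems(7))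
    qed
    then have "poly u' w = poly v w * (F w - \<gamma>)"
      using F_ne[OF less.prems(7)] by (simp add: F1_def u1_def field_simps)
    then show ?thesis by (simp add: u'_def algebra_simps)
  qed
qed

section \<open>Schur functions and finite Blaschke products\<close>

lemma one_minus_cnj_mult_nonzero:
  assumes "norm a < 1" "norm z \<le> 1"
  shows "1 - cnj a * z \<noteq> 0"
proof -
  have "norm (cnj a * z) < 1"
    using mult_right_le_one_le[of "norm a" "norm z"] assms by (simp add: norm_mult)
  then show ?thesis by auto
qed

lemma norm_diff_eq_on_circle:
  assumes "norm z = 1"
  shows "norm (z - a) = norm (1 - cnj a * z)"
proof -
  have "1 - cnj a * z = cnj (z - a) * z"
    using complex_norm_square[of z] assms by (simp add: algebra_simps)
  then show ?thesis using assms by (simp only: norm_mult complex_mod_cnj mult_1_right)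
qed

lemma blaschke_productE:
  assumes "b \<in> blaschke_products k"
  obtains c a where "norm c = 1" "\<And>i. i < k \<Longrightarrow> norm (a i) < 1"
    "\<And>z. z \<in> ball 0 1 \<Longrightarrow> b z = c * (\<Prod>i<k. (z - a i) / (1 - cnj (a i) * z))"
proof -
  from assms obtain c a where "norm c = 1" "\<forall>i<k. a i \<in> ball 0 1"
    "\<forall>z\<in>ball 0 1. b z = c * (\<Prod>i<k. (z - a i) / (1 - cnj (a i) * z))"
    unfolding blaschke_products_def by blast
  then show thesis by (intro that[of c a]) simp_all
qed

lemma blaschke_product_in_schur_class:
  assumes "b \<in> blaschke_products k"
  shows "b \<in> schur_class"
proof -
  obtain c a where c: "norm c = 1" and a: "\<And>i. i < k \<Longrightarrow> norm (a i) < 1"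
    and b: "\<And>z. z \<in> ball 0 1 \<Longrightarrow> b z = c * (\<Prod>i<k. (z - a i) / (1 - cnj (a i) * z))"
    using assms by (rule blaschke_productE) (rule that, assumption, blast+)
  have "(\<lambda>z. c * (\<Prod>i<k. (z - a i) / (1 - cnj (a i) * z))) holomorphic_on ball 0 1"
    by (intro holomorphic_intros) (use a one_minus_cnj_mult_nonzero in auto)
  then have "b holomorphic_on ball 0 1"
    by (rule holomorphic_transform) (simp add: b)
  moreover have "norm (b z) \<le> 1" if z: "z \<in> ball 0 1" for z
  proof -
    have "norm ((z - a i) / (1 - cnj (a i) * z)) \<le> 1" if "i < k" for i
      using Moebius_function_norm_lt_1[of "a i" z 0] a[OF that] z
      by (simp add: Moebius_function_simple)
    then have "norm (\<Prod>i<k. (z - a i) / (1 - cnj (a i) * z)) \<le> 1"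
      unfolding prod_norm[symmetric] by (intro prod_le_1) auto
    then show ?thesis using b[OF z] c by (simp add: norm_mult)
  qed
  ultimately show ?thesis by (simp add: schur_class_def)
qed

lemma schur_class_mult:
  assumes "s \<in> schur_class" "s' \<in> schur_class"
  shows "(\<lambda>z. s z * s' z) \<in> schur_class"
  using assms by (auto simp: schur_class_def norm_mult intro!: holomorphic_intros mult_le_one)

lemma blaschke_products_mult:
  assumes "b \<in> blaschke_products k" "b' \<in> blaschke_products k'"
  shows "(\<lambda>z. b z * b' z) \<in> blaschke_products (k + k')"
proof -
  obtain c a where c: "norm c = 1" and a: "\<And>i. i < k \<Longrightarrow> norm (a i) < 1"
    and b: "\<And>z. z \<in> ball 0 1 \<Longrightarrow> b z = c * (\<Prod>i<k. (z - a i) / (1 - cnj (a i) * z))"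
    using assms(1) by (rule blaschke_productE) (rule that, assumption, blast+)
  obtain c' a' where c': "norm c' = 1" and a': "\<And>i. i < k' \<Longrightarrow> norm (a' i) < 1"
    and b': "\<And>z. z \<in> ball 0 1 \<Longrightarrow> b' z = c' * (\<Prod>i<k'. (z - a' i) / (1 - cnj (a' i) * z))"
    using assms(2) by (rule blaschke_productE) (rule that, assumption, blast+)
  define d where "d i = (if i < k then a i else a' (i - k))" for i
  have split: "(\<Prod>i<k + k'. h (d i)) = (\<Prod>i<k. h (a i)) * (\<Prod>i<k'. h (a' i))" for h :: "complex \<Rightarrow> complex"
  proof (induction k')
    case 0
    then show ?case by (auto simp: d_def intro: prod.cong)
  next
    case (Suc k')
    then show ?case by (simp add: d_def mult.assoc)
  qed
  show ?thesis
    unfolding blaschke_products_def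
  proof (intro CollectI exI conjI ballI allI impI)
    show "norm (c * c') = 1" using c c' by (simp add: norm_mult)
    show "d i \<in> ball 0 1" if "i < k + k'" for i
      using that a a' by (auto simp: d_def)
    show "b z * b' z = c * c' * (\<Prod>i<k + k'. (z - d i) / (1 - cnj (d i) * z))"
      if "z \<in> ball 0 1" for z
      using split[of "\<lambda>x. (z - x) / (1 - cnj x * z)"] b[OF that] b'[OF that] by (simp add: mult_ac)
  qed
qed

lemma schur_constant_if_unimodular_value:
  assumes "s \<in> schur_class" "\<xi> \<in> ball 0 1" "norm (s \<xi>) = 1" "z \<in> ball 0 1"
  shows "s z = s \<xi>"
proof -
  have "s constant_on ball 0 1"
    by (rule maximum_modulus_principle[where U = "ball 0 1" and \<xi> = \<xi>])
       (use assms in \<open>auto simp: schur_class_def\<close>)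
  then show ?thesis using assms by (auto simp: constant_on_def)
qed

section \<open>Rigidity at a boundary point of the disk\<close>

lemma prod_linear_polys:
  fixes p q :: "nat \<Rightarrow> 'a::idom"
  assumes "\<And>i. i < n \<Longrightarrow> q i \<noteq> 0"
  shows "degree (\<Prod>i<n. [:p i, q i:]) = n"
    and "coeff (\<Prod>i<n. [:p i, q i:]) n = (\<Prod>i<n. q i)"
proof -
  show deg: "degree (\<Prod>i<n. [:p i, q i:]) = n"
    by (subst degree_prod_sum_eq) (use assms in auto)
  have "lead_coeff (\<Prod>i<n. [:p i, q i:]) = (\<Prod>i<n. lead_coeff [:p i, q i:])"
    by (rule lead_coeff_prod)
  also have "\<dots> = (\<Prod>i<n. q i)"
    by (rule prod.cong) (use assms in auto)
  finally show "coeff (\<Prod>i<n. [:p i, q i:]) n = (\<Prod>i<n. q i)"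
    by (simp only: deg)
qed

text \<open>
  The Cayley transforms of \<open>S\<close> and \<open>B\<close>, read in the half-plane variable, satisfy the hypotheses
  of \<open>half_plane_rigidity\<close>: a Blaschke product is unimodular on the circle, so its transform is
  imaginary on the imaginary axis, and its numerator and denominator have degree \<open>n\<close>.
\<close>

theorem blaschke_boundary_rigidity:
  fixes S B :: "complex \<Rightarrow> complex" and t0 :: complex
  assumes S: "S \<in> schur_class" and B: "B \<in> blaschke_products n" and t0: "norm t0 = 1"
    and lim: "(\<lambda>\<rho>::real. S (of_real \<rho> * t0) - B (of_real \<rho> * t0)) \<in> o[at_left 1](\<lambda>\<rho>. of_real (1 - \<rho>) ^ (2 * n + 1))"
    and z: "z \<in> ball 0 1"
  shows "S z = B z"
proof -
  obtain c a where c: "norm c = 1" and a: "\<And>i. i < n \<Longrightarrow> norm (a i) < 1"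
    and B_eq: "\<And>z. z \<in> ball 0 1 \<Longrightarrow> B z = c * (\<Prod>i<n. (z - a i) / (1 - cnj (a i) * z))"
    using B by (rule blaschke_productE) (rule that, assumption, blast+)
  \<comment> \<open>The inverse of \<open>z \<mapsto> (t0 + z) / (t0 - z)\<close>. The positive reals correspond to the radius
      towards \<open>t0\<close>, and infinity corresponds to \<open>t0\<close>.\<close>
  define Z where "Z w = t0 * ((w - 1) / (w + 1))" for w
  have Z_ball: "Z w \<in> ball 0 1" if "Re w > 0" for w
  proof -
    have "(cmod (w - 1))\<^sup>2 < (cmod (w + 1))\<^sup>2"
      using norm_add_cnj_sq[of w 1] that by simp
    then have "cmod (w - 1) < cmod (w + 1)" using norm_ge_zero power2_less_imp_less by blast
    moreover from this have "cmod (w + 1) > 0" using norm_ge_zero by (rule order.strict_trans1[rotated])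
    ultimately show ?thesis using t0 by (simp add: Z_def norm_mult norm_divide)
  qed
  \<comment> \<open>Clearing denominators, \<open>P\<close> and \<open>Q\<close> are \<open>(w + 1) ^ n\<close> times the numerator and the denominator
      of the Blaschke product at \<open>Z w\<close>.\<close>
  define P where "P = (\<Prod>i<n. [:- (t0 + a i), t0 - a i:])"
  define Q where "Q = (\<Prod>i<n. [:1 + cnj (a i) * t0, 1 - cnj (a i) * t0:])"
  have ne: "t0 - a i \<noteq> 0" "1 - cnj (a i) * t0 \<noteq> 0" if "i < n" for i
    using a[OF that] t0 one_minus_cnj_mult_nonzero by auto
  have degP: "degree P = n" and lcP: "coeff P n = (\<Prod>i<n. t0 - a i)"
    unfolding P_def by (rule prod_linear_polys; use ne in simp)+
  have degQ: "degree Q = n" and lcQ: "coeff Q n = (\<Prod>i<n. 1 - cnj (a i) * t0)"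
    unfolding Q_def by (rule prod_linear_polys; use ne in simp)+
  have lcQ_ne: "coeff Q n \<noteq> 0" unfolding lcQ using ne by simp
  have polyP: "poly P w = (\<Prod>i<n. (w + 1) * (Z w - a i))"
    and polyQ: "poly Q w = (\<Prod>i<n. (w + 1) * (1 - cnj (a i) * Z w))" if "w \<noteq> -1" for w
  proof -
    have "w + 1 \<noteq> 0" using that by (metis add_eq_0_iff2)
    then have "(w + 1) * Z w = t0 * (w - 1)" by (simp add: Z_def)
    then show "poly P w = (\<Prod>i<n. (w + 1) * (Z w - a i))"
      "poly Q w = (\<Prod>i<n. (w + 1) * (1 - cnj (a i) * Z w))"
      by (auto simp: P_def Q_def poly_prod right_diff_distrib mult.left_commute[of "w + 1"]
          intro!: prod.cong) (simp_all add: algebra_simps)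
  qed
  have Q_ne: "poly Q w \<noteq> 0" and BZ: "B (Z w) = c * (poly P w / poly Q w)" if w: "Re w > 0" for w
  proof -
    have w1: "w \<noteq> -1" "w + 1 \<noteq> 0" using w by (auto simp: complex_eq_iff)
    have "1 - cnj (a i) * Z w \<noteq> 0" if "i < n" for i
      using Z_ball[OF w] a[OF that] by (intro one_minus_cnj_mult_nonzero) auto
    then show "poly Q w \<noteq> 0" using w1 by (simp add: polyQ)
    show "B (Z w) = c * (poly P w / poly Q w)"
      using w1 by (simp add: B_eq[OF Z_ball[OF w]] polyP polyQ flip: prod_dividef)
  qed
  have PQ_axis: "cmod (poly P (\<i> * of_real y)) = cmod (poly Q (\<i> * of_real y))" for y
  proof -
    have "\<i> * of_real y \<noteq> -1" by (simp add: complex_eq_iff)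
    note poly = polyP[OF this] polyQ[OF this]
    have Z1: "cmod (Z (\<i> * of_real y)) = 1"
    proof -
      have "cmod (\<i> * of_real y - 1) = cmod (\<i> * of_real y + 1)"
        by (simp add: cmod_def)
      moreover have "cmod (\<i> * of_real y + 1) \<noteq> 0" by (simp add: complex_eq_iff)
      ultimately show ?thesis using t0 by (simp add: Z_def norm_mult norm_divide)
    qed
    show ?thesis unfolding poly
      by (simp add: norm_mult norm_diff_eq_on_circle[OF Z1] flip: prod_norm)
  qed
  \<comment> \<open>The boundary value of \<open>B\<close> at \<open>t0\<close>, and the rotation \<open>e\<close> that moves it to -1, away from the
      pole 1 of the Cayley transform \<open>(1 + s) / (1 - s)\<close>.\<close>
  define \<beta> where "\<beta> = c * (coeff P n / coeff Q n)"
  define e where "e = - cnj \<beta>"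
  have "norm (coeff P n) = norm (coeff Q n)"
    unfolding lcP lcQ by (simp add: norm_diff_eq_on_circle[OF t0] flip: prod_norm)
  then have "norm \<beta> = 1" using c lcQ_ne by (simp add: \<beta>_def norm_mult norm_divide)
  then have e: "norm e = 1" "e * \<beta> = -1" "e \<noteq> 0"
    using complex_norm_square[of \<beta>] by (auto simp: e_def mult.commute)
  have limB: "((\<lambda>x. B (Z (of_real x))) \<longlongrightarrow> \<beta>) at_top"
  proof -
    have "Q \<noteq> 0" using lcQ_ne by auto
    then have "((\<lambda>w. poly P w / poly Q w) \<longlongrightarrow> coeff P n / coeff Q n) at_infinity"
      using poly_quotient_tendsto[of P Q] by (simp only: degP degQ order_refl not_False_eq_True True_implies_equals)
    then have "((\<lambda>x. c * (poly P (of_real x) / poly Q (of_real x))) \<longlongrightarrow> \<beta>) at_top"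
      unfolding \<beta>_def
      by (intro tendsto_mult tendsto_const filterlim_compose[OF _ filterlim_complex_of_real_at_infinity])
    moreover have "eventually (\<lambda>x. c * (poly P (of_real x) / poly Q (of_real x)) = B (Z (of_real x))) at_top"
      by (rule eventually_mono[OF eventually_gt_at_top[of 0]]) (simp add: BZ)
    ultimately show ?thesis by (rule Lim_transform_eventually)
  qed
  \<comment> \<open>For \<open>\<rho> = (x - 1) / (x + 1)\<close> one has \<open>1 - \<rho> = 2 / (x + 1)\<close>, so powers of \<open>1 - \<rho>\<close> become powers
      of \<open>1 / x\<close> up to a factor that converges.\<close>
  let ?D = "\<lambda>x::real. S (Z (of_real x)) - B (Z (of_real x))"
  have limD: "((\<lambda>x. of_real x ^ (2 * n + 1) * ?D x) \<longlongrightarrow> 0) at_top"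
  proof -
    have "((\<lambda>\<rho>. (S (of_real \<rho> * t0) - B (of_real \<rho> * t0)) / of_real (1 - \<rho>) ^ (2 * n + 1)) \<longlongrightarrow> 0) (at_left 1)"
      by (rule smalloD_tendsto[OF lim])
    moreover have "filterlim (\<lambda>x::real. (x - 1) / (x + 1)) (at_left 1) at_top"
      by real_asymp
    ultimately have "((\<lambda>x. (S (of_real ((x - 1) / (x + 1)) * t0) - B (of_real ((x - 1) / (x + 1)) * t0))
        / of_real (1 - (x - 1) / (x + 1)) ^ (2 * n + 1)) \<longlongrightarrow> 0) at_top"
      by (rule filterlim_compose)
    moreover have "((\<lambda>x::real. of_real (2 * x / (x + 1)) ^ (2 * n + 1)) \<longlongrightarrow> (of_real 2 :: complex) ^ (2 * n + 1)) at_top"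
      by (intro tendsto_power tendsto_of_real) real_asymp
    ultimately have "((\<lambda>x. (S (of_real ((x - 1) / (x + 1)) * t0) - B (of_real ((x - 1) / (x + 1)) * t0))
        / of_real (1 - (x - 1) / (x + 1)) ^ (2 * n + 1) * of_real (2 * x / (x + 1)) ^ (2 * n + 1)) \<longlongrightarrow> 0 * of_real 2 ^ (2 * n + 1)) at_top"
      by (rule tendsto_mult)
    moreover have "eventually (\<lambda>x. (S (of_real ((x - 1) / (x + 1)) * t0) - B (of_real ((x - 1) / (x + 1)) * t0))
        / of_real (1 - (x - 1) / (x + 1)) ^ (2 * n + 1) * of_real (2 * x / (x + 1)) ^ (2 * n + 1)
        = of_real x ^ (2 * n + 1) * ?D x) at_top"
    proof (rule eventually_mono[OF eventually_gt_at_top[of 0]])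
      fix x :: real assume x: "x > 0"
      have "Z (of_real x) = of_real ((x - 1) / (x + 1)) * t0" by (simp add: Z_def)
      moreover have "2 * x / (x + 1) = (1 - (x - 1) / (x + 1)) * x" "1 - (x - 1) / (x + 1) \<noteq> 0"
        using x by (auto simp: field_simps)
      ultimately show "(S (of_real ((x - 1) / (x + 1)) * t0) - B (of_real ((x - 1) / (x + 1)) * t0))
        / of_real (1 - (x - 1) / (x + 1)) ^ (2 * n + 1) * of_real (2 * x / (x + 1)) ^ (2 * n + 1)
        = of_real x ^ (2 * n + 1) * ?D x"
        by (simp only: of_real_mult power_mult_distrib) (simp del: of_real_diff of_real_divide)
    qed
    ultimately show ?thesis using Lim_transform_eventually by fastforce
  qed
  have limS: "((\<lambda>x. S (Z (of_real x))) \<longlongrightarrow> \<beta>) at_top"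
  proof -
    have "((\<lambda>x. inverse (of_real x) ^ (2 * n + 1) * (of_real x ^ (2 * n + 1) * ?D x) + B (Z (of_real x)))
        \<longlongrightarrow> 0 ^ (2 * n + 1) * 0 + \<beta>) at_top"
      by (intro tendsto_add tendsto_mult tendsto_power limD limB tendsto_inverse_complex_of_real)
    moreover have "eventually (\<lambda>x. inverse (of_real x) ^ (2 * n + 1) * (of_real x ^ (2 * n + 1) * ?D x) + B (Z (of_real x))
        = S (Z (of_real x))) at_top"
      by (rule eventually_mono[OF eventually_gt_at_top[of 0]])
         (simp add: field_simps)
    ultimately show ?thesis using Lim_transform_eventually by fastforce
  qed
  have S_le: "norm (S z) \<le> 1" if "z \<in> ball 0 1" for z using S that by (simp add: schur_class_def)
  \<comment> \<open>By the maximum principle \<open>e * S\<close> could take the value 1 only as a constant, but it tends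
      to -1 along the radius.\<close>
  have S_ne: "1 - e * S (Z w) \<noteq> 0" if w: "Re w > 0" for w
  proof
    assume "1 - e * S (Z w) = 0"
    then have 1: "e * S (Z w) = 1" by simp
    then have "norm (e * S (Z w)) = 1" by simp
    then have "norm (S (Z w)) = 1" using e by (simp add: norm_mult)
    from schur_constant_if_unimodular_value[OF S Z_ball[OF w] this Z_ball]
    have "eventually (\<lambda>x. e * S (Z (of_real x)) = 1) at_top"
      by (intro eventually_mono[OF eventually_gt_at_top[of 0]]) (simp add: 1)
    with tendsto_mult[OF tendsto_const[of e] limS] have "((\<lambda>x::real. 1) \<longlongrightarrow> e * \<beta>) at_top"
      by (rule Lim_transform_eventually)
    then show False using e by (simp add: tendsto_const_iff)
  qed
  define F where "F w = (1 + e * S (Z w)) / (1 - e * S (Z w))" for w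
  define u v where "u = Q + smult (e * c) P" and "v = Q - smult (e * c) P"
  \<comment> \<open>The leading coefficients of \<open>Q\<close> and \<open>e * c * P\<close> are opposite, so that \<open>v\<close> has full degree.\<close>
  have eP: "e * c * coeff P n = - coeff Q n"
    using e(2) lcQ_ne by (simp add: \<beta>_def field_simps)
  have coeff_v: "coeff v n = 2 * coeff Q n" using eP by (simp add: v_def)
  have "degree v \<le> n" unfolding v_def
    by (rule degree_diff_le) (use degP degQ e c in auto)
  then have deg_v: "degree v = n"
    using coeff_v lcQ_ne by (intro le_antisym le_degree) auto
  have "F w * poly v w = poly u w" if "Re w > 0" for w
  proof (rule half_plane_rigidity)
    show "F holomorphic_on {w. Re w > 0}"
    proof -
      have "Z holomorphic_on {w. Re w > 0}"
        unfolding Z_def by (intro holomorphic_intros) (auto simp: complex_eq_iff)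
      moreover have "S holomorphic_on ball 0 1" using S by (simp add: schur_class_def)
      ultimately have "(S \<circ> Z) holomorphic_on {w. Re w > 0}"
        by (rule holomorphic_on_compose_gen) (use Z_ball in auto)
      then have *: "(\<lambda>w. S (Z w)) holomorphic_on {w. Re w > 0}" by (simp add: o_def)
      show ?thesis unfolding F_def by (intro holomorphic_intros *) (use S_ne in auto)
    qed
    show "Re (F w) \<ge> 0" if "Re w > 0" for w
    proof -
      have "norm (e * S (Z w)) \<le> 1" using S_le[OF Z_ball[OF that]] e by (simp add: norm_mult)
      then have "(norm (e * S (Z w)))\<^sup>2 \<le> 1" by (simp add: power_le_one)
      then have "Re ((1 + e * S (Z w)) * cnj (1 - e * S (Z w))) \<ge> 0"
        unfolding cmod_power2 by (simp add: power2_eq_square algebra_simps)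
      then show ?thesis unfolding F_def Re_quotient by (rule divide_nonneg_nonneg) simp
    qed
    show "degree u \<le> degree v" unfolding deg_v u_def
      by (rule degree_add_le) (use degP degQ e c in auto)
    show "v \<noteq> 0" using coeff_v lcQ_ne by auto
    show "Re (poly u (\<i> * y) * cnj (poly v (\<i> * y))) = 0" for y :: real
    proof -
      define p q where "p = e * c * poly P (\<i> * y)" and "q = poly Q (\<i> * y)"
      have "cmod p = cmod q" using PQ_axis e c by (simp add: p_def q_def norm_mult)
      then have "(cmod p)\<^sup>2 = (cmod q)\<^sup>2" by simp
      then have "Re ((q + p) * cnj (q - p)) = 0"
        unfolding cmod_power2 by (simp add: power2_eq_square algebra_simps)
      then show ?thesis by (simp add: u_def v_def p_def q_def)
    qed
    show "((\<lambda>x. of_real x ^ (2 * degree v + 1) * (F (of_real x) - poly u (of_real x) / poly v (of_real x))) \<longlongrightarrow> 0) at_top"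
    proof -
      have "((\<lambda>x. 2 * e * (of_real x ^ (2 * n + 1) * ?D x)
          / ((1 - e * S (Z (of_real x))) * (1 - e * B (Z (of_real x)))))
          \<longlongrightarrow> 2 * e * 0 / ((1 - e * \<beta>) * (1 - e * \<beta>))) at_top"
        by (intro tendsto_divide tendsto_mult tendsto_diff tendsto_const limD limS limB)
           (simp add: e)
      moreover have "eventually (\<lambda>x. 2 * e * (of_real x ^ (2 * n + 1) * ?D x)
          / ((1 - e * S (Z (of_real x))) * (1 - e * B (Z (of_real x))))
          = of_real x ^ (2 * degree v + 1) * (F (of_real x) - poly u (of_real x) / poly v (of_real x))) at_top"
        using eventually_gt_at_top[of 0] eventually_poly_nonzero[OF \<open>v \<noteq> 0\<close>]
      proof eventually_elim
        case (elim x)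
        define s b where "s = e * S (Z (of_real x))" and "b = e * B (Z (of_real x))"
        have Q: "poly Q (of_real x) \<noteq> 0" using Q_ne elim by simp
        have uv: "poly u (of_real x) = poly Q (of_real x) * (1 + b)" "poly v (of_real x) = poly Q (of_real x) * (1 - b)"
          using BZ[of "of_real x"] elim Q by (simp_all add: u_def v_def b_def field_simps)
        have ne: "1 - s \<noteq> 0" "1 - b \<noteq> 0"
          using S_ne[of "of_real x"] elim uv by (auto simp: s_def)
        have "F (of_real x) - poly u (of_real x) / poly v (of_real x) = (1 + s) / (1 - s) - (1 + b) / (1 - b)"
          using Q by (simp add: uv F_def s_def)
        also have "\<dots> = 2 * (s - b) / ((1 - s) * (1 - b))"
          using ne by (simp add: field_simps)
        also have "s - b = e * ?D x" by (simp add: s_def b_def algebra_simps)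
        finally show ?case by (simp add: deg_v s_def b_def)
      qed
      ultimately show ?thesis using Lim_transform_eventually by fastforce
    qed
  qed (rule that)
  note Fvu = this
  define w where "w = (t0 + z) / (t0 - z)"
  have tz: "t0 - z \<noteq> 0" using z t0 by auto
  have "Z w = z"
  proof -
    have "w - 1 = 2 * z / (t0 - z)" "w + 1 = 2 * t0 / (t0 - z)"
      using tz by (simp_all add: w_def field_simps)
    then show ?thesis using tz t0 by (auto simp: Z_def)
  qed
  have Re_w: "Re w > 0"
  proof -
    have "Re ((t0 + z) * cnj (t0 - z)) = (norm t0)\<^sup>2 - (norm z)\<^sup>2"
      unfolding cmod_power2 by (simp add: power2_eq_square algebra_simps)
    also have "\<dots> > 0" using t0 z by (simp add: abs_square_less_1)
    finally show ?thesis unfolding w_def Re_quotient by (rule divide_pos_pos) (use tz in simp)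
  qed
  \<comment> \<open>Both transforms agree at \<open>w\<close>, and the Cayley transform is injective.\<close>
  have "F w * poly v w = poly u w" by (rule Fvu[OF Re_w])
  moreover have "poly v w = poly Q w * (1 - e * B z)" "poly u w = poly Q w * (1 + e * B z)"
    using BZ[OF Re_w] Q_ne[OF Re_w] \<open>Z w = z\<close> by (simp_all add: u_def v_def field_simps)
  moreover have "F w * (1 - e * S z) = 1 + e * S z"
    using S_ne[OF Re_w] by (simp add: F_def \<open>Z w = z\<close>)
  ultimately have "(1 + e * S z) * (1 - e * B z) = (1 + e * B z) * (1 - e * S z)"
    using Q_ne[OF Re_w] by (metis (no_types, opaque_lifting) mult.assoc mult.commute mult_left_cancel)
  then show ?thesis using e by (simp add: algebra_simps)
qed

section \<open>Rigidity for quotients\<close>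

theorem corollary2p3:
  fixes \<kappa> r l :: nat and f g :: "complex \<Rightarrow> complex" and t0 :: complex
  assumes "g \<in> blaschke_quotients l r"
    and "t0 \<in> sphere 0 1"
    and "f \<in> generalized_schur_class \<kappa>"
    and "\<And>M. M > 1 \<Longrightarrow>
      (\<lambda>z. f z - g z) \<in> o[at t0 within stolz_angle t0 M](\<lambda>z. (z - t0) ^ (2 * \<kappa> + 2 * l + 1))"
  shows "\<forall>z\<in>ball 0 1. f z = g z"
proof
  fix z :: complex assume z: "z \<in> ball 0 1"
  obtain h \<theta> where h: "h \<in> blaschke_products l" and \<theta>: "\<theta> \<in> blaschke_products r"
    and h\<theta>: "no_common_zeros h \<theta>" and g: "\<And>z. z \<in> ball 0 1 \<Longrightarrow> g z = h z / \<theta> z"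
    using assms(1) by (auto simp: blaschke_quotients_def)
  obtain s b where s: "s \<in> schur_class" and b: "b \<in> blaschke_products \<kappa>"
    and sb: "no_common_zeros s b" and f: "\<And>z. z \<in> ball 0 1 \<Longrightarrow> f z = s z / b z"
    using assms(3) by (auto simp: generalized_schur_class_def)
  have t0: "norm t0 = 1" using assms(2) by simp
  have b\<theta>: "(\<lambda>z. b z * \<theta> z) \<in> blaschke_products (\<kappa> + r)"
    by (rule blaschke_products_mult[OF b \<theta>])
  \<comment> \<open>The radius lies in the Stolz angle of aperture 2, because \<open>\<bar>\<rho> t0 - t0\<bar> = 1 - \<rho>\<close> there.\<close>
  have radial: "filterlim (\<lambda>\<rho>::real. of_real \<rho> * t0) (at t0 within stolz_angle t0 2) (at_left 1)"
  proof -
    have "((\<lambda>\<rho>::real. of_real \<rho> * t0) \<longlongrightarrow> of_real 1 * t0) (at_left 1)"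
      by (intro tendsto_intros)
    moreover have "eventually (\<lambda>\<rho>::real. of_real \<rho> * t0 \<in> stolz_angle t0 2 \<and> of_real \<rho> * t0 \<noteq> t0) (at_left 1)"
      using eventually_at_left_real[of 0 "1::real", OF zero_less_one]
    proof eventually_elim
      case (elim \<rho>)
      have "of_real \<rho> * t0 - t0 = - (of_real (1 - \<rho>) * t0)" by (simp add: algebra_simps)
      then have "norm (of_real \<rho> * t0 - t0) = 1 - \<rho>"
        using elim t0 by (simp only: norm_minus_cancel norm_mult norm_of_real) simp
      then show ?case using elim t0 by (auto simp: stolz_angle_def norm_mult)
    qed
    ultimately show ?thesis by (simp add: filterlim_at)
  qed
  have "(\<lambda>\<rho>::real. s (of_real \<rho> * t0) * \<theta> (of_real \<rho> * t0) - b (of_real \<rho> * t0) * h (of_real \<rho> * t0))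
      \<in> o[at_left 1](\<lambda>\<rho>. of_real (1 - \<rho>) ^ (2 * (\<kappa> + l) + 1))"
  proof -
    have "(\<lambda>\<rho>::real. f (of_real \<rho> * t0) - g (of_real \<rho> * t0))
        \<in> o[at_left 1](\<lambda>\<rho>. (of_real \<rho> * t0 - t0) ^ (2 * \<kappa> + 2 * l + 1))"
      by (rule landau_o.small.compose[OF assms(4) radial]) simp
    moreover have "(\<lambda>\<rho>::real. s (of_real \<rho> * t0) * \<theta> (of_real \<rho> * t0) - b (of_real \<rho> * t0) * h (of_real \<rho> * t0))
        \<in> O[at_left 1](\<lambda>\<rho>. f (of_real \<rho> * t0) - g (of_real \<rho> * t0))"
    \<comment> \<open>The zeros of \<open>b * \<theta>\<close>, where \<open>f\<close> or \<open>g\<close> has a pole, are finitely many points inside the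
        disk, so the radius avoids them near \<open>t0\<close>.\<close>
    proof (rule bigoI[of _ 1])
      obtain c a where c: "norm c = 1" and a: "\<And>i. i < \<kappa> + r \<Longrightarrow> norm (a i) < 1"
        and b\<theta>_eq: "\<And>z. z \<in> ball 0 1 \<Longrightarrow> b z * \<theta> z = c * (\<Prod>i<\<kappa> + r. (z - a i) / (1 - cnj (a i) * z))"
        using b\<theta> by (rule blaschke_productE) (rule that, assumption, blast+)
      have "((\<lambda>\<rho>::real. of_real \<rho> * t0) \<longlongrightarrow> of_real 1 * t0) (at_left 1)"
        by (intro tendsto_intros)
      then have "eventually (\<lambda>\<rho>::real. of_real \<rho> * t0 \<noteq> a i) (at_left 1)" if "i < \<kappa> + r" for i
        by (rule tendsto_imp_eventually_ne) (use a[OF that] t0 in auto)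
      then have "eventually (\<lambda>\<rho>::real. \<forall>i\<in>{..<\<kappa> + r}. of_real \<rho> * t0 \<noteq> a i) (at_left 1)"
        by (intro eventually_ball_finite) auto
      with eventually_at_left_real[of 0 "1::real", OF zero_less_one]
      show "eventually (\<lambda>\<rho>. norm (s (of_real \<rho> * t0) * \<theta> (of_real \<rho> * t0) - b (of_real \<rho> * t0) * h (of_real \<rho> * t0))
          \<le> 1 * norm (f (of_real \<rho> * t0) - g (of_real \<rho> * t0))) (at_left 1)"
      proof eventually_elim
        case (elim \<rho>)
        define \<zeta> where "\<zeta> = of_real \<rho> * t0"
        have \<zeta>: "\<zeta> \<in> ball 0 1" using elim t0 by (simp add: \<zeta>_def norm_mult)
        have "b \<zeta> * \<theta> \<zeta> \<noteq> 0"
          using elim(2) a \<zeta> c one_minus_cnj_mult_nonzero[of _ \<zeta>] by (auto simp: b\<theta>_eq \<zeta>_def)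
        then have "s \<zeta> * \<theta> \<zeta> - b \<zeta> * h \<zeta> = (b \<zeta> * \<theta> \<zeta>) * (f \<zeta> - g \<zeta>)"
          by (simp add: f[OF \<zeta>] g[OF \<zeta>] field_simps)
        moreover have "norm (b \<zeta> * \<theta> \<zeta>) \<le> 1"
          using blaschke_product_in_schur_class[OF b\<theta>] \<zeta> by (simp add: schur_class_def)
        ultimately have "norm (s \<zeta> * \<theta> \<zeta> - b \<zeta> * h \<zeta>) \<le> 1 * norm (f \<zeta> - g \<zeta>)"
          by (simp only: norm_mult) (intro mult_right_mono, auto)
        then show ?case by (simp add: \<zeta>_def)
      qed
    qed
    ultimately have "(\<lambda>\<rho>::real. s (of_real \<rho> * t0) * \<theta> (of_real \<rho> * t0) - b (of_real \<rho> * t0) * h (of_real \<rho> * t0))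
        \<in> o[at_left 1](\<lambda>\<rho>. (of_real \<rho> * t0 - t0) ^ (2 * \<kappa> + 2 * l + 1))"
      by (rule landau_o.big_small_trans[rotated])
    moreover have "norm ((of_real \<rho> * t0 - t0) ^ k) = norm (of_real (1 - \<rho>) ^ k :: complex)" for \<rho> :: real and k
    proof -
      have "of_real \<rho> * t0 - t0 = - (of_real (1 - \<rho>) * t0)" by (simp add: algebra_simps)
      then show ?thesis using t0 by (simp only: norm_minus_cancel norm_power norm_mult) simp
    qed
    ultimately show ?thesis
      unfolding smallo_def mem_Collect_eq distrib_left by (simp only:)
  qed
  from blaschke_boundary_rigidity[OF schur_class_mult[OF s blaschke_product_in_schur_class[OF \<theta>]]
      blaschke_products_mult[OF b h] t0 this z]
  have eq: "s z * \<theta> z = b z * h z" .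
  show "f z = g z"
  \<comment> \<open>A pole of one quotient is a pole of the other: by coprimeness, \<open>b z = 0\<close> makes \<open>s z\<close>
      nonzero and hence \<open>\<theta> z = 0\<close>, and conversely. Both quotients then have the default value 0.\<close>
  proof (cases "b z = 0 \<or> \<theta> z = 0")
    case True
    then have "b z = 0" "\<theta> z = 0"
      using eq sb h\<theta> z by (auto simp: no_common_zeros_def)
    then show ?thesis using f[OF z] g[OF z] by simp
  next
    case False
    then have "s z / b z = h z / \<theta> z" using eq by (simp add: frac_eq_eq mult.commute)
    then show ?thesis using f[OF z] g[OF z] by simp
  qed
qed

end
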